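(* Let $B$ be a derivation-finite algebra over a field $\mathbf{k}$. Let $S$ be a subset of $\operatorname{LFD}_{\mathbf{k}}(B)$ that is closed under the Lie bracket (i.e., $[D,E]\in S$ for all $D,E\in S$), and define the sequence of sets $(S_i)_{i\in\mathbb{N}}$ by $S_0=S$ and $S_{n+1}=\{\,[D,E] \mid D,E\in S_n\,\}$ for each $n\in\mathbb{N}$. Then: (a) $S_0\supseteq S_1\supseteq S_2\supseteq\cdots$ and each set $S_n$ is closed under the Lie bracket. (b) If there exists $n\in\mathbb{N}$ such that $S_n$ is a weakly locally finite set, then $S$ is a weakly locally finite set.
   Context: An algebra over a field $\mathbf{k}$ is a $\mathbf{k}$-vector space $B$ together with an arbitrary $\mathbf{k}$-bilinear map $B\times B\to B$, $(x,y)\mapsto x\cdot y$ (not assumed commutative, associative or unital). A $\mathbf{k}$-derivation of $B$ is a $\mathbf{k}$-linear map $D:B\to B$ with $D(x\cdot y)=D(x)\cdot y+x\cdot D(y)$ for all $x,y\in B$. The set $\operatorname{Der}_{\mathbf{k}}(B)$ of all $\mathbf{k}$-derivations of $B$ is a Lie algebra over $\mathbf{k}$ with bracket $[D,E]=D\circ E-E\circ D$. $B$ is derivation-finite if there exists a finite subset $F$ of $B$ such that the only $D\in\operatorname{Der}_{\mathbf{k}}(B)$ satisfying $D(x)=0$ for all $x\in F$ is $D=0$. A subset $\Delta$ of $\operatorname{Der}_{\mathbf{k}}(B)$ is locally finite if for each $b\in B$ there exists a finite dimensional $\mathbf{k}$-linear subspace $U$ of $B$ such that $b\in U$ and $D(U)\subseteq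 U$ for all $D\in\Delta$. It is weakly locally finite if every finite subset of $\Delta$ is locally finite. A derivation $D\in\operatorname{Der}_{\mathbf{k}}(B)$ is locally finite if $\{D\}$ is a locally finite set; $\operatorname{LFD}_{\mathbf{k}}(B)$ denotes the set of locally finite $\mathbf{k}$-derivations of $B$. $\mathbb{N}$ includes $0$. *)

theory Defs
  imports Complex_Main
begin

text \<open>The commutator bracket of two self-maps of an additive group.\<close>

definition lie_bracket ::
    "('b::ab_group_add \<Rightarrow> 'b) \<Rightarrow> ('b \<Rightarrow> 'b) \<Rightarrow> ('b \<Rightarrow> 'b)"
  where "lie_bracket D E = (\<lambda>x. (D \<circ> E) x - (E \<circ> D) x)"

definition bracket_closed :: "('b::ab_group_add \<Rightarrow> 'b) set \<Rightarrow> bool"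
  where "bracket_closed S \<longleftrightarrow> (\<forall>D\<in>S. \<forall>E\<in>S. lie_bracket D E \<in> S)"

text \<open>The set in the successor step consists of the brackets themselves; no span is taken.\<close>

primrec bracket_seq ::
    "('b::ab_group_add \<Rightarrow> 'b) set \<Rightarrow> nat \<Rightarrow> ('b \<Rightarrow> 'b) set"
  where
    "bracket_seq S 0 = S"
  | "bracket_seq S (Suc n) =
       {lie_bracket D E | D E. D \<in> bracket_seq S n \<and> E \<in> bracket_seq S n}"

text \<open>
  The whole type \<open>'b\<close> carries the algebra, and the product is an arbitrary bilinear map.
  It is a locale parameter rather than the type class operation, since the
  algebra need not be associative, commutative or unital.
\<close>

locale nonassoc_algebra = vector_space scale
  for scale :: "'a::field \<Rightarrow> 'b::ab_group_add \<Rightarrow> 'b" (infixr \<open>*s\<close> 75) +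
  fixes mult :: "'b \<Rightarrow> 'b \<Rightarrow> 'b" (infixl \<open>\<cdot>\<close> 70)
  assumes linear_mult_right: "Vector_Spaces.linear scale scale (\<lambda>y. x \<cdot> y)"
    and linear_mult_left: "Vector_Spaces.linear scale scale (\<lambda>x. x \<cdot> y)"
begin

definition Der :: "('b \<Rightarrow> 'b) set"
  where "Der = {D. Vector_Spaces.linear scale scale D \<and>
                   (\<forall>x y. D (x \<cdot> y) = D x \<cdot> y + x \<cdot> D y)}"

definition derivation_finite :: bool
  where "derivation_finite \<longleftrightarrow>
    (\<exists>F. finite F \<and> (\<forall>D\<in>Der. (\<forall>x\<in>F. D x = 0) \<longrightarrow> D = (\<lambda>_. 0)))"

definition finite_dim_subspace :: "'b set \<Rightarrow> bool"
  where "finite_dim_subspace U \<longleftrightarrow>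
    subspace U \<and> (\<exists>X. finite X \<and> independent X \<and> span X = U)"

text \<open>
  The next two predicates are meant for subsets \<open>\<Delta>\<close> of \<^term>\<open>Der\<close>.
  They make sense for arbitrary sets of self-maps, so that inclusion is not built in.
\<close>

definition locally_finite :: "('b \<Rightarrow> 'b) set \<Rightarrow> bool"
  where "locally_finite \<Delta> \<longleftrightarrow>
    (\<forall>b. \<exists>U. finite_dim_subspace U \<and> b \<in> U \<and> (\<forall>D\<in>\<Delta>. D ` U \<subseteq> U))"

definition weakly_locally_finite :: "('b \<Rightarrow> 'b) set \<Rightarrow> bool"
  where "weakly_locally_finite \<Delta> \<longleftrightarrow>
    (\<forall>\<Gamma>. finite \<Gamma> \<and> \<Gamma> \<subseteq> \<Delta> \<longrightarrow> locally_finite \<Gamma>)"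

definition LFD :: "('b \<Rightarrow> 'b) set"
  where "LFD = {D \<in> Der. locally_finite {D}}"

end

end

theory Submission
  imports Defs "HOL-Library.Function_Algebras"
begin

text \<open>
  The heart of the proof is an extension principle (\<open>weakly_locally_finite_insert\<close>): a locally
  finite derivation \<open>D\<close> can be added to a weakly locally finite set \<open>T\<close> of derivations, provided
  that \<open>[D, E] \<in> T\<close> for all \<open>E \<in> T\<close>.

  Let \<open>\<Gamma> \<subseteq> T\<close> be finite. Derivation-finiteness gives a finite set \<open>F\<close> such that a derivation is
  determined by its values on \<open>F\<close>. Choose finite-dimensional \<open>D\<close>-stable subspaces \<open>U \<supseteq> F\<close> and
  \<open>W \<supseteq> \<Union>(E ` U)\<close>, where \<open>E\<close> ranges over \<open>\<Gamma>\<close>. The elements of \<open>T\<close> mapping \<open>U\<close> into \<open>W\<close> form a set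
  \<open>X\<close> which contains \<open>\<Gamma>\<close>, is stable under \<open>[D, \<cdot>]\<close>, and embeds linearly into the
  finite-dimensional space of maps \<open>F \<rightarrow> W\<close>. So \<open>X\<close> lies in the span of a finite subset \<open>X'\<close>
  (\<open>finite_spanning_subset\<close>), and \<open>X' \<subseteq> T\<close> is locally finite. Given a vector \<open>b\<close>, let \<open>U\<^sub>0\<close> be a
  finite-dimensional \<open>D\<close>-stable subspace containing \<open>b\<close> and \<open>W\<^sub>0\<close> the least \<open>X'\<close>-stable subspace
  containing \<open>U\<^sub>0\<close>. It is finite-dimensional since \<open>X'\<close> is locally finite, and because \<open>D\<close> normalises the span of \<open>X'\<close> it
  is \<open>D\<close>-stable as well (\<open>locally_finite_insert\<close>); it is the subspace required for
  \<open>\<Gamma> \<union> {D}\<close>.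

  For the theorem, note that \<open>[D, E] \<in> S\<^sub>1\<close> for all \<open>D, E \<in> S\<close>. Hence the elements of a finite
  subset of \<open>S\<close> can be added to \<open>S\<^sub>1\<close> one at a time, so that weak local finiteness passes from
  \<open>S\<^sub>1\<close> to \<open>S\<close>, and by induction from \<open>S\<^sub>n\<close> to \<open>S\<close>.
\<close>

section \<open>Finite-dimensional stable subspaces\<close>

context nonassoc_algebra
begin

abbreviation (input) fscale :: "'a \<Rightarrow> ('b \<Rightarrow> 'b) \<Rightarrow> 'b \<Rightarrow> 'b"
  where "fscale c f \<equiv> (\<lambda>x. c *s f x)"

interpretation maps: vector_space fscale
  by unfold_locales (auto simp: fun_eq_iff algebra_simps)

lemma linear_add: "Vector_Spaces.linear scale scale D \<Longrightarrow> D (x + y) = D x + D y"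
  and linear_scale: "Vector_Spaces.linear scale scale D \<Longrightarrow> D (c *s x) = c *s D x"
  unfolding Vector_Spaces.linear_iff by blast+

lemma linear_zero: "Vector_Spaces.linear scale scale D \<Longrightarrow> D 0 = 0"
  using linear_scale[of D 0 0] by simp

lemma Der_linear: "D \<in> Der \<Longrightarrow> Vector_Spaces.linear scale scale D"
  by (simp add: Der_def)

lemma finite_dim_subspace_iff:
  "finite_dim_subspace U \<longleftrightarrow> subspace U \<and> (\<exists>X. finite X \<and> U \<subseteq> span X)"
proof
  assume "finite_dim_subspace U"
  then show "subspace U \<and> (\<exists>X. finite X \<and> U \<subseteq> span X)"
    by (auto simp: finite_dim_subspace_def)
next
  assume U: "subspace U \<and> (\<exists>X. finite X \<and> U \<subseteq> span X)"
  obtain B where B: "B \<subseteq> U" "independent B" "U \<subseteq> span B"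
    using maximal_independent_subset[of U] by blast
  have "finite B" using U B independent_span_bound by blast
  moreover have "span B = U" using B U span_minimal by blast
  ultimately show "finite_dim_subspace U" using U B by (auto simp: finite_dim_subspace_def)
qed

lemma subspace_linear_preimage:
  assumes "Vector_Spaces.linear scale scale D" "subspace U" "subspace V"
  shows "subspace {x \<in> U. D x \<in> V}"
  using assms by (auto simp: subspace_def linear_zero linear_add linear_scale)

lemma subspace_Der: "maps.subspace Der"
proof -
  have mult: "x \<cdot> (y + z) = x \<cdot> y + x \<cdot> z" "(x + y) \<cdot> z = x \<cdot> z + y \<cdot> z"
    "x \<cdot> (c *s y) = c *s (x \<cdot> y)" "(c *s x) \<cdot> y = c *s (x \<cdot> y)"
    "x \<cdot> 0 = 0" "0 \<cdot> y = 0" for x y z c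
    using linear_add[OF linear_mult_right] linear_add[OF linear_mult_left]
      linear_scale[OF linear_mult_right] linear_scale[OF linear_mult_left]
      linear_zero[OF linear_mult_right] linear_zero[OF linear_mult_left] by blast+
  show ?thesis
    by (auto simp: maps.subspace_def Der_def Vector_Spaces.linear_iff vector_space_axioms
        mult algebra_simps)
qed

text \<open>
  A sum of finitely many stable subspaces of finite dimension is again one, so local finiteness,
  which speaks of single vectors, extends to finite sets of vectors.
\<close>

lemma finite_dim_invariant_superset:
  assumes "locally_finite \<Delta>" "\<forall>D\<in>\<Delta>. Vector_Spaces.linear scale scale D" "finite A"
  shows "\<exists>U. finite_dim_subspace U \<and> A \<subseteq> U \<and> (\<forall>D\<in>\<Delta>. D ` U \<subseteq> U)"
  using \<open>finite A\<close>
proof (induction A)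
  case empty
  show ?case
    by (rule exI[of _ "{0}"])
      (use assms(2) in \<open>auto simp: finite_dim_subspace_iff linear_zero intro: exI[of _ "{}"]\<close>)
next
  case (insert a A)
  then obtain U where U: "finite_dim_subspace U" "A \<subseteq> U" "\<forall>D\<in>\<Delta>. D ` U \<subseteq> U" by blast
  obtain V where V: "finite_dim_subspace V" "a \<in> V" "\<forall>D\<in>\<Delta>. D ` V \<subseteq> V"
    using assms(1) unfolding locally_finite_def by blast
  let ?W = "span (U \<union> V)"
  obtain X Y where XY: "finite X" "U \<subseteq> span X" "finite Y" "V \<subseteq> span Y"
    using U(1) V(1) by (auto simp: finite_dim_subspace_iff)
  have "?W \<subseteq> span (X \<union> Y)"
    using XY span_mono[of X "X \<union> Y"] span_mono[of Y "X \<union> Y"] by (intro span_minimal) auto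
  then have "finite_dim_subspace ?W"
    using XY(1,3) by (auto simp: finite_dim_subspace_iff)
  moreover have "D ` ?W \<subseteq> ?W" if D: "D \<in> \<Delta>" for D
  proof -
    have "?W \<subseteq> {x \<in> ?W. D x \<in> ?W}"
    proof (rule span_minimal)
      show "U \<union> V \<subseteq> {x \<in> ?W. D x \<in> ?W}"
        using U(3) V(3) D span_superset[of "U \<union> V"] by blast
      show "subspace {x \<in> ?W. D x \<in> ?W}"
        using assms(2) D by (intro subspace_linear_preimage) auto
    qed
    then show ?thesis by blast
  qed
  moreover have "insert a A \<subseteq> ?W" using U(2) V(2) span_superset[of "U \<union> V"] by blast
  ultimately show ?case by blast
qed

section \<open>Spans of derivations\<close>

text \<open>
  For finite \<open>F\<close>, the restriction of \<open>f\<close> to \<open>F\<close>, extended by \<open>0\<close>, is a sum over \<open>a \<in> F\<close> of maps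
  supported at \<open>a\<close>, and the map with value \<open>w\<close> at \<open>a\<close> depends linearly on \<open>w\<close>.
\<close>

lemma restrictions_finitely_spanned:
  assumes "finite F" "finite Y"
  shows "\<exists>Z. finite Z \<and>
    (\<forall>f. (\<forall>x\<in>F. f x \<in> span Y) \<longrightarrow> (\<lambda>x. if x \<in> F then f x else 0) \<in> maps.span Z)"
  using \<open>finite F\<close>
proof (induction F)
  case empty
  have "(\<lambda>x. 0) = (0 :: 'b \<Rightarrow> 'b)" by (simp add: fun_eq_iff)
  then show ?case by (intro exI[of _ "{}"]) auto
next
  case (insert a F)
  then obtain Z where Z: "finite Z"
    "\<And>f. (\<forall>x\<in>F. f x \<in> span Y) \<Longrightarrow> (\<lambda>x. if x \<in> F then f x else 0) \<in> maps.span Z"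
    by blast
  let ?\<delta> = "\<lambda>w x. if x = a then w else 0"
  have \<delta>: "?\<delta> w \<in> maps.span (Z \<union> ?\<delta> ` Y)" if "w \<in> span Y" for w
    using that
  proof (induction rule: span_induct_alt)
    case base
    have "?\<delta> 0 = 0" by (auto simp: fun_eq_iff)
    then show ?case by (metis maps.span_zero)
  next
    case (step c y w)
    have "?\<delta> (c *s y + w) = fscale c (?\<delta> y) + ?\<delta> w" by (auto simp: fun_eq_iff)
    moreover have "?\<delta> y \<in> maps.span (Z \<union> ?\<delta> ` Y)"
      using step.hyps by (intro maps.span_base) blast
    ultimately show ?case
      using step.IH maps.span_add maps.span_scale by metis
  qed
  have "(\<lambda>x. if x \<in> insert a F then f x else 0) \<in> maps.span (Z \<union> ?\<delta> ` Y)"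
    if f: "\<forall>x\<in>insert a F. f x \<in> span Y" for f
  proof -
    have "(\<lambda>x. if x \<in> insert a F then f x else 0) = (\<lambda>x. if x \<in> F then f x else 0) + ?\<delta> (f a)"
      using insert.hyps by (auto simp: fun_eq_iff)
    moreover have "(\<lambda>x. if x \<in> F then f x else 0) \<in> maps.span (Z \<union> ?\<delta> ` Y)"
      using Z(2)[of f] f maps.span_mono[of Z "Z \<union> ?\<delta> ` Y"] by blast
    ultimately show ?thesis using \<delta>[of "f a"] f maps.span_add by simp
  qed
  then show ?case using Z(1) \<open>finite Y\<close> by (intro exI[of _ "Z \<union> ?\<delta> ` Y"]) blast
qed

text \<open>
  Restriction to \<open>F\<close> is injective on derivations, so a basis of the restrictions of \<open>X\<close> to \<open>F\<close>,
  chosen among those restrictions, lifts to a spanning set of \<open>X\<close>.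
\<close>

lemma finite_spanning_subset:
  assumes F: "finite F" "\<forall>D\<in>Der. (\<forall>x\<in>F. D x = 0) \<longrightarrow> D = (\<lambda>_. 0)"
    and X: "X \<subseteq> Der" "\<forall>E\<in>X. E ` F \<subseteq> W" and W: "finite_dim_subspace W"
  shows "\<exists>X'. finite X' \<and> X' \<subseteq> X \<and> X \<subseteq> maps.span X'"
proof -
  let ?r = "\<lambda>f x. if x \<in> F then f x else 0"
  obtain Y where Y: "finite Y" "span Y = W" using W by (auto simp: finite_dim_subspace_def)
  obtain Z where Z: "finite Z" "\<And>f. (\<forall>x\<in>F. f x \<in> W) \<Longrightarrow> ?r f \<in> maps.span Z"
    using restrictions_finitely_spanned[OF F(1) Y(1)] Y(2) by blast
  obtain B where B: "B \<subseteq> ?r ` X" "maps.independent B" "?r ` X \<subseteq> maps.span B"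
    using maps.maximal_independent_subset[of "?r ` X"] by blast
  have "B \<subseteq> maps.span Z" using B(1) X(2) Z(2) by blast
  then have "finite B" using maps.independent_span_bound[OF Z(1) B(2)] by blast
  then obtain X' where X': "X' \<subseteq> X" "finite X'" "B = ?r ` X'"
    using B(1) by (meson finite_subset_image)
  have lift: "\<exists>g\<in>maps.span X'. ?r g = h" if "h \<in> maps.span (?r ` X')" for h
    using that
  proof (induction rule: maps.span_induct_alt)
    case base
    have "?r 0 = 0" by (auto simp: fun_eq_iff)
    then show ?case using maps.span_zero by blast
  next
    case (step c y h)
    then obtain f g where f: "f \<in> X'" "y = ?r f" and g: "g \<in> maps.span X'" "?r g = h" by blast
    have "?r (fscale c f + g) = fscale c y + h"
      unfolding f(2) g(2)[symmetric] by (auto simp: fun_eq_iff)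
    moreover have "fscale c f + g \<in> maps.span X'"
      using maps.span_add[OF maps.span_scale[OF maps.span_base[OF f(1)]] g(1)] .
    ultimately show ?case by blast
  qed
  have "E \<in> maps.span X'" if E: "E \<in> X" for E
  proof -
    obtain g where g: "g \<in> maps.span X'" "?r g = ?r E" using lift B(3) X'(3) E by blast
    have "g \<in> Der" using maps.span_minimal[OF _ subspace_Der, of X'] X'(1) X(1) g(1) by blast
    then have "E - g \<in> Der" using maps.subspace_diff[OF subspace_Der] E X(1) by blast
    moreover have "(E - g) x = 0" if "x \<in> F" for x
      using fun_cong[OF g(2), of x] that by simp
    ultimately have "E - g = (\<lambda>_. 0)" using F(2) by blast
    then have "E = g" by (auto simp: fun_eq_iff)
    then show ?thesis using g(1) by simp
  qed
  then show ?thesis using X' by blast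
qed

section \<open>Adjoining a normalising derivation\<close>

lemma span_maps_into:
  assumes "E \<in> maps.span X" "subspace W" "\<forall>E'\<in>X. E' x \<in> W"
  shows "E x \<in> W"
  using assms(1)
proof (induction rule: maps.span_induct_alt)
  case base
  show ?case using assms(2) by (simp add: subspace_0)
next
  case (step c y z)
  then show ?case using assms(2,3) by (simp add: subspace_add subspace_scale)
qed

text \<open>
  The least \<open>X\<close>-stable subspace containing a \<open>D\<close>-stable subspace is itself \<open>D\<close>-stable: the
  vectors \<open>w\<close> in it with \<open>D w\<close> in it form an \<open>X\<close>-stable subspace, by
  \<open>D (E w) = E (D w) + [D, E] w\<close>.
\<close>

lemma locally_finite_insert:
  assumes D: "Vector_Spaces.linear scale scale D" "locally_finite {D}"
    and X: "\<forall>E\<in>X. Vector_Spaces.linear scale scale E" "locally_finite X"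
    and norm: "\<forall>E\<in>X. lie_bracket D E \<in> maps.span X"
  shows "locally_finite (insert D (maps.span X))"
  unfolding locally_finite_def
proof
  fix b
  obtain U where U: "finite_dim_subspace U" "b \<in> U" "D ` U \<subseteq> U"
    using finite_dim_invariant_superset[OF D(2), of "{b}"] D(1) by auto
  obtain Y where Y: "finite Y" "span Y = U" using U(1) by (auto simp: finite_dim_subspace_def)
  obtain M where M: "finite_dim_subspace M" "Y \<subseteq> M" "\<forall>E\<in>X. E ` M \<subseteq> M"
    using finite_dim_invariant_superset[OF X(2,1) Y(1)] by blast
  have "subspace M" using M(1) by (simp add: finite_dim_subspace_def)
  have "U \<subseteq> M" using span_minimal[OF M(2) \<open>subspace M\<close>] Y(2) by simp
  let ?stable = "\<lambda>V. subspace V \<and> U \<subseteq> V \<and> (\<forall>E\<in>X. E ` V \<subseteq> V)"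
  define W where "W = \<Inter>{V. ?stable V}"
  have least: "W \<subseteq> V" if "?stable V" for V using that unfolding W_def by blast
  have W: "?stable W"
  proof (intro conjI)
    show "subspace W" unfolding W_def by (intro subspace_Inter) simp
    show "U \<subseteq> W" unfolding W_def by blast
    show "\<forall>E\<in>X. E ` W \<subseteq> W" unfolding W_def by blast
  qed
  have "W \<subseteq> M" using least M(3) \<open>subspace M\<close> \<open>U \<subseteq> M\<close> by blast
  then have fin: "finite_dim_subspace W" using W M(1) unfolding finite_dim_subspace_iff
    by (meson order_trans)
  have spanX: "E w \<in> W" if "E \<in> maps.span X" "w \<in> W" for E w
    using span_maps_into[OF that(1)] that(2) W by blast
  let ?V = "{w \<in> W. D w \<in> W}"
  have "?stable ?V"
  proof (intro conjI ballI)
    show "subspace ?V" using subspace_linear_preimage[OF D(1)] W by blast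
    show "U \<subseteq> ?V" using W U(3) by blast
    fix E assume E: "E \<in> X"
    show "E ` ?V \<subseteq> ?V"
    proof
      fix z assume "z \<in> E ` ?V"
      then obtain w where w: "w \<in> W" "D w \<in> W" "z = E w" by blast
      have "E (D w) \<in> W" using W E w(2) by blast
      moreover have "lie_bracket D E w \<in> W" using spanX norm E w(1) by blast
      moreover have "D (E w) = E (D w) + lie_bracket D E w" by (simp add: lie_bracket_def)
      ultimately have "D (E w) \<in> W" using W subspace_add by metis
      then show "z \<in> ?V" using W E w by blast
    qed
  qed
  then have "D ` W \<subseteq> W" using least by blast
  then have "\<forall>E\<in>insert D (maps.span X). E ` W \<subseteq> W" using spanX by blast
  then show "\<exists>U. finite_dim_subspace U \<and> b \<in> U \<and> (\<forall>E\<in>insert D (maps.span X). E ` U \<subseteq> U)"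
    using fin W U(2) by blast
qed

lemma locally_finite_subset: "locally_finite \<Delta> \<Longrightarrow> \<Gamma> \<subseteq> \<Delta> \<Longrightarrow> locally_finite \<Gamma>"
  unfolding locally_finite_def by (meson subsetD)

text \<open>
  Although \<open>T\<close> may be infinite, the brackets with \<open>D\<close> iterated on finitely many elements of \<open>T\<close>
  stay in a finite-dimensional space of derivations: on the test set \<open>F\<close> they all take values in
  one finite-dimensional subspace. Hence \<open>locally_finite_insert\<close> applies to a finite subset
  of \<open>T\<close>.
\<close>

lemma weakly_locally_finite_insert:
  assumes "derivation_finite" and D: "D \<in> LFD" and T: "T \<subseteq> Der" "weakly_locally_finite T"
    and norm: "\<forall>E\<in>T. lie_bracket D E \<in> T"
  shows "weakly_locally_finite (insert D T)"
  unfolding weakly_locally_finite_def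
proof (intro allI impI)
  fix \<Delta> assume \<Delta>: "finite \<Delta> \<and> \<Delta> \<subseteq> insert D T"
  define \<Gamma> where "\<Gamma> = \<Delta> - {D}"
  have \<Gamma>: "finite \<Gamma>" "\<Gamma> \<subseteq> T" "\<Delta> \<subseteq> insert D \<Gamma>" using \<Delta> by (auto simp: \<Gamma>_def)
  have linD: "Vector_Spaces.linear scale scale D" and lfD: "locally_finite {D}"
    using D by (auto simp: LFD_def Der_linear)
  have linT: "Vector_Spaces.linear scale scale E" if "E \<in> T" for E
    using that T(1) Der_linear by blast
  obtain F where F: "finite F" "\<forall>D\<in>Der. (\<forall>x\<in>F. D x = 0) \<longrightarrow> D = (\<lambda>_. 0)"
    using assms(1) unfolding derivation_finite_def by blast
  obtain U where U: "finite_dim_subspace U" "F \<subseteq> U" "D ` U \<subseteq> U"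
    using finite_dim_invariant_superset[OF lfD _ F(1)] linD by auto
  obtain Y where Y: "finite Y" "span Y = U" using U(1) by (auto simp: finite_dim_subspace_def)
  have "finite (\<Union>E\<in>\<Gamma>. E ` Y)" using Y(1) \<Gamma>(1) by blast
  then obtain W where W: "finite_dim_subspace W" "(\<Union>E\<in>\<Gamma>. E ` Y) \<subseteq> W" "D ` W \<subseteq> W"
    using finite_dim_invariant_superset[OF lfD, of "\<Union>E\<in>\<Gamma>. E ` Y"] linD by auto
  have "subspace W" using W(1) by (simp add: finite_dim_subspace_def)
  \<comment> \<open>Maps sending \<open>U\<close> into \<open>W\<close> are closed under \<open>[D, \<cdot>]\<close>, as \<open>D\<close> preserves both; no
    iterated brackets need to be written down.\<close>
  define X where "X = {E \<in> T. E ` U \<subseteq> W}"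
  have "\<Gamma> \<subseteq> X"
  proof
    fix E assume E: "E \<in> \<Gamma>"
    have "subspace {x \<in> UNIV. E x \<in> W}"
      using linT E \<Gamma>(2) \<open>subspace W\<close> by (intro subspace_linear_preimage) auto
    then have "span Y \<subseteq> {x \<in> UNIV. E x \<in> W}" using W(2) E by (intro span_minimal) auto
    then show "E \<in> X" using E \<Gamma>(2) Y(2) by (auto simp: X_def)
  qed
  have bracketX: "lie_bracket D E \<in> X" if "E \<in> X" for E
    using that norm U(3) W(3) subspace_diff[OF \<open>subspace W\<close>]
    unfolding X_def lie_bracket_def by (auto simp: image_subset_iff)
  have "X \<subseteq> Der" using T(1) by (auto simp: X_def)
  moreover have "\<forall>E\<in>X. E ` F \<subseteq> W" using U(2) unfolding X_def by blast
  ultimately have "\<exists>X'. finite X' \<and> X' \<subseteq> X \<and> X \<subseteq> maps.span X'"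
    using W(1) by (rule finite_spanning_subset[OF F])
  then obtain X' where X': "finite X'" "X' \<subseteq> X" "X \<subseteq> maps.span X'"
    by (elim exE conjE)
  have "X' \<subseteq> T" using X'(2) by (auto simp: X_def)
  have "locally_finite (insert D (maps.span X'))"
  proof (rule locally_finite_insert[OF linD lfD])
    show "\<forall>E\<in>X'. Vector_Spaces.linear scale scale E" using linT \<open>X' \<subseteq> T\<close> by blast
    show "locally_finite X'" using T(2) X'(1) \<open>X' \<subseteq> T\<close> by (simp add: weakly_locally_finite_def)
    show "\<forall>E\<in>X'. lie_bracket D E \<in> maps.span X'" using bracketX X'(2,3) by blast
  qed
  then show "locally_finite \<Delta>"
    by (rule locally_finite_subset) (use \<Gamma>(3) \<open>\<Gamma> \<subseteq> X\<close> X'(3) in blast)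
qed

text \<open>
  Let \<open>S1\<close> be the set of brackets. The union of \<open>S1\<close> with any part of \<open>S\<close> still absorbs all brackets of elements of \<open>S\<close>, so the
  extension principle applies repeatedly, starting from \<open>S1\<close>.
\<close>

lemma weakly_locally_finite_if_brackets:
  assumes "derivation_finite" and S: "S \<subseteq> LFD" "bracket_closed S"
    and wlf: "weakly_locally_finite {lie_bracket D E | D E. D \<in> S \<and> E \<in> S}"
  shows "weakly_locally_finite S"
  unfolding weakly_locally_finite_def
proof (intro allI impI)
  let ?S1 = "{lie_bracket D E | D E. D \<in> S \<and> E \<in> S}"
  have S1: "?S1 \<subseteq> S" using S(2) unfolding bracket_closed_def by blast
  have SDer: "S \<subseteq> Der" using S(1) unfolding LFD_def by blast
  have ext: "\<Gamma> \<subseteq> S \<longrightarrow> weakly_locally_finite (\<Gamma> \<union> ?S1)" if "finite \<Gamma>" for \<Gamma>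
    using that
  proof (induction \<Gamma>)
    case empty
    then show ?case using wlf by simp
  next
    case (insert D \<Gamma>)
    show ?case
    proof
      assume sub: "insert D \<Gamma> \<subseteq> S"
      have "weakly_locally_finite (insert D (\<Gamma> \<union> ?S1))"
      proof (rule weakly_locally_finite_insert[OF assms(1)])
        show "D \<in> LFD" using sub S(1) by blast
        show "\<Gamma> \<union> ?S1 \<subseteq> Der" using sub S1 SDer by blast
        show "weakly_locally_finite (\<Gamma> \<union> ?S1)" using insert.IH sub by blast
        show "\<forall>E\<in>\<Gamma> \<union> ?S1. lie_bracket D E \<in> \<Gamma> \<union> ?S1"
        proof
          fix E assume "E \<in> \<Gamma> \<union> ?S1"
          then have "E \<in> S" using sub S1 by blast
          then show "lie_bracket D E \<in> \<Gamma> \<union> ?S1" using sub by blast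
        qed
      qed
      then show "weakly_locally_finite (insert D \<Gamma> \<union> ?S1)" by simp
    qed
  qed
  fix \<Gamma> assume \<Gamma>: "finite \<Gamma> \<and> \<Gamma> \<subseteq> S"
  then have "weakly_locally_finite (\<Gamma> \<union> ?S1)" using ext by simp
  then have "finite \<Gamma> \<and> \<Gamma> \<subseteq> \<Gamma> \<union> ?S1 \<longrightarrow> locally_finite \<Gamma>"
    unfolding weakly_locally_finite_def by (rule spec)
  then show "locally_finite \<Gamma>" using \<Gamma> by simp
qed

end

section \<open>The sequence of iterated brackets\<close>

lemma bracket_seq_closed_decreasing:
  assumes "bracket_closed S"
  shows "bracket_closed (bracket_seq S n) \<and> bracket_seq S (Suc n) \<subseteq> bracket_seq S n"
proof (induction n)
  case 0
  have "bracket_seq S (Suc 0) \<subseteq> S"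
    using assms unfolding bracket_closed_def bracket_seq.simps by blast
  then show ?case using assms by simp
next
  case (Suc n)
  have "bracket_closed (bracket_seq S (Suc n))"
    unfolding bracket_closed_def
  proof (intro ballI)
    fix D E assume "D \<in> bracket_seq S (Suc n)" "E \<in> bracket_seq S (Suc n)"
    then have "D \<in> bracket_seq S n" "E \<in> bracket_seq S n" using Suc by blast+
    then show "lie_bracket D E \<in> bracket_seq S (Suc n)" unfolding bracket_seq.simps by blast
  qed
  moreover have "bracket_seq S (Suc (Suc n)) \<subseteq> bracket_seq S (Suc n)"
    using calculation unfolding bracket_closed_def bracket_seq.simps(2)[of S "Suc n"] by blast
  ultimately show ?case by blast
qed

theorem mainTheorem1:
  fixes scale :: "'a::field \<Rightarrow> 'b::ab_group_add \<Rightarrow> 'b"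
    and mult :: "'b \<Rightarrow> 'b \<Rightarrow> 'b"
    and S :: "('b \<Rightarrow> 'b) set"
  assumes "nonassoc_algebra scale mult"
    and "nonassoc_algebra.derivation_finite scale mult"
    and "S \<subseteq> nonassoc_algebra.LFD scale mult"
    and "bracket_closed S"
  shows "((\<forall>n. bracket_seq S (Suc n) \<subseteq> bracket_seq S n) \<and>
          (\<forall>n. bracket_closed (bracket_seq S n))) \<and>
         ((\<exists>n. nonassoc_algebra.weakly_locally_finite scale (bracket_seq S n)) \<longrightarrow>
          nonassoc_algebra.weakly_locally_finite scale S)"
proof -
  interpret nonassoc_algebra scale mult by fact
  have closed: "bracket_closed (bracket_seq S n)"
    and decreasing: "bracket_seq S (Suc n) \<subseteq> bracket_seq S n" for n
    using bracket_seq_closed_decreasing[OF assms(4)] by blast+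
  have LFD: "bracket_seq S n \<subseteq> LFD" for n
    by (induction n) (use assms(3) decreasing in \<open>auto simp del: bracket_seq.simps(2)\<close>)
  have "weakly_locally_finite S" if "weakly_locally_finite (bracket_seq S n)" for n
    using that
  proof (induction n)
    case 0
    then show ?case by simp
  next
    case (Suc n)
    then show ?case
      using weakly_locally_finite_if_brackets[OF assms(2) LFD closed, of n] by simp
  qed
  then show ?thesis using closed decreasing by blast
qed

end
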